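(* For $\alpha,\lambda\in\mathbb C$ define $$\mathcal M_{\alpha,\lambda}(z):=\sum_{k\ge0}\binom{\alpha}{k}M_k(\lambda)z^k,$$ where $M_k(\lambda)$ is the matching enumerator of the complete graph $K_k$ defined in the context. Then, for all $\alpha,\lambda\in\mathbb C$, $$\mathcal M_{\alpha,\lambda}\!\left(-\frac{z}{1+2z}\right)=(1+2z)^{-\alpha}\mathcal M_{\alpha,\lambda}(z).$$ Consequently, for every formal power series $h(z)\in\mathbb C[[z]]$ and every integer $r\ge0$, $$[z^r]\,h(z)\mathcal M_{\alpha,\lambda}(z)=[z^r]\,h\!\left(\frac{z}{1-2z}\right)(1-2z)^{r-1-\alpha}\mathcal M_{\alpha,\lambda}(-z).$$
   Context: $[z^r]H(z)$ denotes the coefficient of $z^r$ in the formal power series $H(z)$. For $\beta\in\mathbb C$ and $w\in z\mathbb C[[z]]$, $(1+w)^\beta:=\sum_{k\ge0}\binom{\beta}{k}w^k$. For $0\le j\le\lfloor n/2\rfloor$ let $m_{n,j}:=\frac{n!}{(n-2j)!\,j!\,2^j}$ (the number of $j$-edge matchings of $K_n$), and $M_n(\lambda):=\sum_{j=0}^{\lfloor n/2\rfloor}m_{n,j}\lambda^j$. *)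

theory Defs
  imports
    Complex_Main
    "HOL-Computational_Algebra.Formal_Power_Series"
begin

definition matching_num :: "nat \<Rightarrow> nat \<Rightarrow> complex" where
  "matching_num n j = fact n / (fact (n - 2 * j) * fact j * 2 ^ j)"

definition matching_enum :: "nat \<Rightarrow> complex \<Rightarrow> complex" where
  "matching_enum n l = (\<Sum>j = 0..n div 2. matching_num n j * l ^ j)"

definition matching_fps :: "complex \<Rightarrow> complex \<Rightarrow> complex fps" where
  "matching_fps \<alpha> l = Abs_fps (\<lambda>k. (\<alpha> gchoose k) * matching_enum k l)"

text \<open>
  The power \<open>(1 + w)\<^sup>\<beta>\<close>, for \<open>w\<close> with zero constant term (as
  composition of formal power series requires). The series \<open>fps_binomial \<beta>\<close> has
  the coefficients \<open>\<beta> gchoose k\<close>.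
\<close>
definition fps_one_plus_powr :: "complex fps \<Rightarrow> complex \<Rightarrow> complex fps" where
  "fps_one_plus_powr w \<beta> = fps_binomial \<beta> oo w"

end

theory Submission
  imports Defs
begin

text \<open>
  Summing over the number \<open>k - 2j\<close> of unmatched vertices first gives
  \<open>M(z) = \<Sum>j. c\<^sub>j z\<^sup>2\<^sup>j (1 + z)\<^bsup>\<alpha> - 2j\<^esup>\<close>. The substitution
  \<open>z \<mapsto> -z/(1 + 2z)\<close> sends \<open>1 + z\<close> to \<open>(1 + z)/(1 + 2z)\<close>, so it multiplies every summand by
  \<open>(1 + 2z)\<^bsup>-\<alpha>\<^esup>\<close>. The coefficient identity is this symmetry combined with the change of
  variables \<open>z = w/(1 - 2w)\<close> in the residue of \<open>F(z)/z\<^bsup>r + 1\<^esup>\<close>.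
\<close>

unbundle fps_syntax

lemma fps_one_plus_powr_nth_0 [simp]: "fps_one_plus_powr w b $ 0 = 1"
  by (simp add: fps_one_plus_powr_def)

lemma fps_one_plus_powr_X: "fps_one_plus_powr fps_X b = fps_binomial b"
  by (simp add: fps_one_plus_powr_def)

lemma fps_one_plus_powr_add:
  assumes "w $ 0 = 0"
  shows "fps_one_plus_powr w (a + b) = fps_one_plus_powr w a * fps_one_plus_powr w b"
  using assms by (simp add: fps_one_plus_powr_def fps_binomial_add_mult fps_compose_mult_distrib)

lemma fps_one_plus_powr_minus:
  assumes "w $ 0 = 0"
  shows "fps_one_plus_powr w b * fps_one_plus_powr w (- b) = 1"
  using fps_one_plus_powr_add [OF assms, of b "- b"] by (simp add: fps_one_plus_powr_def)

lemma fps_one_plus_powr_of_nat: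
  assumes "w $ 0 = 0"
  shows "fps_one_plus_powr w (of_nat n) = (1 + w) ^ n"
  using assms
  by (simp add: fps_one_plus_powr_def fps_binomial_of_nat fps_compose_power [symmetric]
      fps_compose_add_distrib)

lemma fps_one_plus_powr_compose:
  assumes "w $ 0 = 0" "v $ 0 = 0"
  shows "fps_one_plus_powr w b oo v = fps_one_plus_powr (w oo v) b"
  using assms by (simp add: fps_one_plus_powr_def fps_compose_assoc)

text \<open>The chain rule applied to the differential equation of the binomial series. Keeping the
  factor \<open>1 + w\<close> on the left avoids division.\<close>

lemma fps_one_plus_powr_deriv:
  assumes "w $ 0 = 0"
  shows "(1 + w) * fps_deriv (fps_one_plus_powr w b)
    = fps_const b * fps_one_plus_powr w b * fps_deriv w"
proof -
  have "(1 + fps_X) * fps_deriv (fps_binomial b) = fps_const b * fps_binomial b"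
    by (simp add: fps_binomial_deriv fps_divide_unit mult.commute mult.left_commute
        inverse_mult_eq_1')
  then have "((1 + fps_X) * fps_deriv (fps_binomial b)) oo w = (fps_const b * fps_binomial b) oo w"
    by simp
  then have "(1 + w) * (fps_deriv (fps_binomial b) oo w) = fps_const b * fps_one_plus_powr w b"
    using assms by (simp add: fps_compose_mult_distrib fps_compose_add_distrib fps_one_plus_powr_def)
  then show ?thesis
    using assms by (simp add: fps_one_plus_powr_def fps_compose_deriv mult.assoc [symmetric])
qed

text \<open>The base on the right is \<open>(1 + u) * (1 + v)\<close>. For complex \<open>b\<close>
  the law follows from differential equations: the quotient of the two sides has derivative 0 and
  constant term 1.\<close>

lemma fps_one_plus_powr_mult:
  assumes u: "u $ 0 = 0" and v: "v $ 0 = 0"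
  shows "fps_one_plus_powr u b * fps_one_plus_powr v b = fps_one_plus_powr (u + v + u * v) b"
proof -
  define t where "t = u + v + u * v"
  have t: "t $ 0 = 0" using u v by (simp add: t_def)
  \<comment> \<open>\<open>T\<close> is the inverse of the claimed product, so the goal becomes
    \<open>U * V * T = 1\<close>.\<close>
  define U V T where "U = fps_one_plus_powr u b" and "V = fps_one_plus_powr v b"
    and "T = fps_one_plus_powr t (- b)"
  have U: "(1 + u) * fps_deriv U = fps_const b * U * fps_deriv u"
    and V: "(1 + v) * fps_deriv V = fps_const b * V * fps_deriv v"
    and T: "(1 + t) * fps_deriv T = fps_const (- b) * T * fps_deriv t"
    unfolding U_def V_def T_def by (simp_all only: fps_one_plus_powr_deriv u v t)
  \<comment> \<open>Since \<open>1 + t = (1 + u) * (1 + v)\<close>, each term of the Leibniz rule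
    receives the factor that its differential equation needs.\<close>
  have "(1 + t) * fps_deriv (U * V * T)
    = (1 + v) * ((1 + u) * fps_deriv U) * V * T + (1 + u) * ((1 + v) * fps_deriv V) * U * T
      + U * V * ((1 + t) * fps_deriv T)"
    by (simp add: t_def algebra_simps)
  also have "\<dots> = fps_const b * U * V * T * ((1 + v) * fps_deriv u + (1 + u) * fps_deriv v)
      + fps_const (- b) * U * V * T * fps_deriv t"
    unfolding U V T by (simp add: algebra_simps)
  also have "\<dots> = fps_const b * U * V * T *
      ((1 + v) * fps_deriv u + (1 + u) * fps_deriv v - fps_deriv t)"
    by (simp add: algebra_simps flip: fps_const_neg)
  also have "(1 + v) * fps_deriv u + (1 + u) * fps_deriv v - fps_deriv t = 0"
    by (simp add: t_def algebra_simps)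
  finally have "(1 + t) * fps_deriv (U * V * T) = 0" by simp
  moreover have "(1 + t) \<noteq> 0"
    using t by (metis add.right_neutral fps_add_nth fps_one_nth fps_zero_nth zero_neq_one)
  ultimately have "fps_deriv (U * V * T) = 0" by (metis mult_eq_0_iff)
  then have "U * V * T = fps_const ((U * V * T) $ 0)" by (simp only: fps_deriv_eq_0_iff)
  then have UVT: "U * V * T = 1" by (simp add: U_def V_def T_def)
  have "fps_one_plus_powr t b * T = 1"
    unfolding T_def using t by (rule fps_one_plus_powr_minus)
  then have "U * V = U * V * (fps_one_plus_powr t b * T)" by simp
  also have "\<dots> = fps_one_plus_powr t b * (U * V * T)" by (simp only: mult_ac)
  finally have "U * V = fps_one_plus_powr t b" by (simp add: UVT)
  then show ?thesis by (simp add: U_def V_def t_def)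
qed

text \<open>With the next lemma, this allows an infinite series to be replaced by a truncation
  whenever a single coefficient is compared.\<close>

lemma fps_compose_cong_nth:
  assumes "\<And>i. i \<le> n \<Longrightarrow> f $ i = g $ i"
  shows "(f oo w) $ n = (g oo w) $ n"
  using assms by (simp add: fps_compose_nth)

lemma fps_nth_mult_cong:
  assumes "\<And>i. i \<le> n \<Longrightarrow> f $ i = g $ i"
  shows "(f * h) $ n = (g * h) $ n"
  using assms by (simp add: fps_mult_nth)

text \<open>The quotient \<open>fact (2 * j) / (fact j * 2 ^ j)\<close> counts the perfect matchings
  of the complete graph on \<open>2 * j\<close> vertices.\<close>

definition matching_coeff :: "complex \<Rightarrow> complex \<Rightarrow> nat \<Rightarrow> complex" where
  "matching_coeff \<alpha> l j = (\<alpha> gchoose (2 * j)) * fact (2 * j) / (fact j * 2 ^ j) * l ^ j"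

text \<open>A finite sum, so that composition distributes over it. The summand for \<open>j\<close>
  starts in degree \<open>2 * j\<close>, hence truncating at \<open>N\<close> leaves the
  coefficients up to degree \<open>N\<close> intact.\<close>

definition matching_partial :: "nat \<Rightarrow> complex \<Rightarrow> complex \<Rightarrow> complex fps" where
  "matching_partial N \<alpha> l = (\<Sum>j\<le>N. fps_const (matching_coeff \<alpha> l j)
     * (fps_X ^ (2 * j) * fps_binomial (\<alpha> - of_nat (2 * j))))"

text \<open>A matching with \<open>j\<close> edges is a choice of \<open>2 * j\<close> vertices and
  a perfect matching on them; trinomial revision then moves that choice from \<open>n\<close> to
  \<alpha>.\<close>

lemma gchoose_mult_matching_num:
  assumes "2 * j \<le> n"
  shows "(\<alpha> gchoose n) * (matching_num n j * l ^ j)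
    = matching_coeff \<alpha> l j * (\<alpha> - of_nat (2 * j) gchoose (n - 2 * j))"
proof -
  have "of_nat n gchoose (2 * j) = (fact n / (fact (2 * j) * fact (n - 2 * j)) :: complex)"
    using assms by (simp only: binomial_gbinomial [symmetric] binomial_fact)
  then have "(\<alpha> gchoose n) * (fact n / (fact (2 * j) * fact (n - 2 * j)))
      = (\<alpha> gchoose (2 * j)) * (\<alpha> - of_nat (2 * j) gchoose (n - 2 * j))"
    using gbinomial_trinomial_revision [OF assms, of \<alpha>] by simp
  then have "(\<alpha> gchoose n) * fact n / fact (n - 2 * j)
      = (\<alpha> gchoose (2 * j)) * (\<alpha> - of_nat (2 * j) gchoose (n - 2 * j)) * fact (2 * j)"
    by (simp add: field_simps)
  then have "(\<alpha> gchoose n) * fact n / fact (n - 2 * j) * (l ^ j / (fact j * 2 ^ j))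
      = (\<alpha> gchoose (2 * j)) * (\<alpha> - of_nat (2 * j) gchoose (n - 2 * j)) * fact (2 * j)
         * (l ^ j / (fact j * 2 ^ j))"
    by (simp only:)
  then show ?thesis
    unfolding matching_num_def matching_coeff_def by (simp add: mult_ac)
qed

lemma matching_fps_nth_eq_partial:
  assumes "n \<le> N"
  shows "matching_fps \<alpha> l $ n = matching_partial N \<alpha> l $ n"
proof -
  have "matching_fps \<alpha> l $ n
      = (\<Sum>j = 0..n div 2. matching_coeff \<alpha> l j * (\<alpha> - of_nat (2 * j) gchoose (n - 2 * j)))"
    unfolding matching_fps_def matching_enum_def fps_nth_Abs_fps sum_distrib_left
    by (intro sum.cong gchoose_mult_matching_num) auto
  also have "\<dots> = (\<Sum>j\<le>N. if n < 2 * j then 0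
      else matching_coeff \<alpha> l j * (\<alpha> - of_nat (2 * j) gchoose (n - 2 * j)))"
    using assms by (intro sum.mono_neutral_cong_left) auto
  also have "\<dots> = matching_partial N \<alpha> l $ n"
    unfolding matching_partial_def fps_sum_nth fps_mult_left_const_nth fps_X_power_mult_nth
      fps_binomial_nth
    by (intro sum.cong) auto
  finally show ?thesis .
qed

text \<open>The hypothesis says \<open>w\<close> = -z/(1 + 2z) without division. The symmetry is
  checked summand by summand.\<close>

lemma matching_partial_compose:
  assumes w: "w * (1 + 2 * fps_X) = - fps_X"
  shows "matching_partial N \<alpha> l oo w
    = fps_one_plus_powr (2 * fps_X) (- \<alpha>) * matching_partial N \<alpha> l"
proof -
  let ?P = "fps_one_plus_powr (2 * fps_X)"
  have "(w * (1 + 2 * fps_X)) $ 0 = (- fps_X :: complex fps) $ 0" by (simp only: w)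
  then have w0: "w $ 0 = 0" by simp
  have X0: "(2 * fps_X :: complex fps) $ 0 = 0" by simp
  \<comment> \<open>That is, (1 + w)(1 + 2z) = 1 + z.\<close>
  have sum_eq: "w + 2 * fps_X + w * (2 * fps_X) = fps_X"
    using w by (simp add: algebra_simps)
  have prod: "fps_one_plus_powr w c * ?P c = fps_binomial c" for c
    using fps_one_plus_powr_mult [OF w0 X0, of c] by (simp only: sum_eq fps_one_plus_powr_X)
  have binom: "fps_binomial c oo w = fps_binomial c * ?P (- c)" for c
  proof -
    have "fps_binomial c * ?P (- c) = fps_one_plus_powr w c * (?P c * ?P (- c))"
      by (simp only: prod [symmetric] mult.assoc)
    then show ?thesis
      by (simp only: fps_one_plus_powr_minus [OF X0] mult_1_right fps_one_plus_powr_def [of w])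
  qed
  have term_eq: "(fps_X ^ (2 * j) * fps_binomial (\<alpha> - of_nat (2 * j))) oo w
      = ?P (- \<alpha>) * (fps_X ^ (2 * j) * fps_binomial (\<alpha> - of_nat (2 * j)))" for j
  proof -
    \<comment> \<open>The sign disappears because the exponent is even. The factor (1 + 2z)^(2j)
      gained here absorbs the dependence on \<open>j\<close> of the exponent
      \<open>- (\<alpha> - of_nat (2 * j))\<close>.\<close>
    have "fps_X ^ (2 * j) = (w * (1 + 2 * fps_X)) ^ (2 * j)"
      unfolding w by simp
    then have X: "fps_X ^ (2 * j) = w ^ (2 * j) * ?P (of_nat (2 * j))"
      by (simp only: power_mult_distrib fps_one_plus_powr_of_nat [OF X0])
    have "?P (- (\<alpha> - of_nat (2 * j))) = ?P (- \<alpha>) * ?P (of_nat (2 * j))"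
      using fps_one_plus_powr_add [OF X0, of "- \<alpha>" "of_nat (2 * j)"] by simp
    moreover have "fps_X ^ (2 * j) oo w = w ^ (2 * j)"
      using w0 by (simp add: fps_compose_power [symmetric])
    ultimately show ?thesis
      unfolding fps_compose_mult_distrib [OF w0] binom by (simp only: X) (simp only: mult_ac)
  qed
  show ?thesis
    unfolding matching_partial_def fps_compose_sum_distrib sum_distrib_left
      fps_compose_mult_distrib [OF w0, of "fps_const _"] term_eq fps_const_compose
    by (simp only: mult.left_commute)
qed

lemma matching_fps_compose:
  assumes "w * (1 + 2 * fps_X) = - fps_X"
  shows "matching_fps \<alpha> l oo w = fps_one_plus_powr (2 * fps_X) (- \<alpha>) * matching_fps \<alpha> l"
proof (rule fps_ext)
  fix n
  have eq: "matching_fps \<alpha> l $ i = matching_partial n \<alpha> l $ i" if "i \<le> n" for i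
    using that by (rule matching_fps_nth_eq_partial)
  have "(matching_fps \<alpha> l oo w) $ n = (matching_partial n \<alpha> l oo w) $ n"
    by (rule fps_compose_cong_nth) (rule eq)
  also have "\<dots> = (matching_partial n \<alpha> l * fps_one_plus_powr (2 * fps_X) (- \<alpha>)) $ n"
    by (simp add: matching_partial_compose [OF assms] mult.commute)
  also have "\<dots> = (matching_fps \<alpha> l * fps_one_plus_powr (2 * fps_X) (- \<alpha>)) $ n"
    by (rule fps_nth_mult_cong) (simp add: eq)
  finally show "(matching_fps \<alpha> l oo w) $ n
      = (fps_one_plus_powr (2 * fps_X) (- \<alpha>) * matching_fps \<alpha> l) $ n"
    by (simp add: mult.commute)
qed

text \<open>Residue form: for z = x/(1 - 2x), dz/z^(r+1) equals (1 - 2x)^(r-1) dx/x^(r+1). By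
  linearity it is enough to check the powers of z up to degree \<open>r\<close>. The exponent is
  complex, so \<open>r = 0\<close> gives -1.\<close>

lemma fps_nth_compose_mobius:
  fixes F g :: "complex fps"
  assumes g: "g * (1 - 2 * fps_X) = fps_X"
  shows "((F oo g) * fps_one_plus_powr (- (2 * fps_X)) (of_nat r - 1)) $ r = F $ r"
proof -
  let ?Q = "fps_one_plus_powr (- (2 * fps_X))"
  have "(g * (1 - 2 * fps_X)) $ 0 = (fps_X :: complex fps) $ 0" by (simp only: g)
  then have g0: "g $ 0 = 0" by simp
  have X0: "(- (2 * fps_X) :: complex fps) $ 0 = 0" by simp
  have Q_nth: "?Q c $ n = (- 2) ^ n * (c gchoose n)" for c n
  proof -
    have "- (2 * fps_X) = fps_const (- 2 :: complex) * fps_X"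
      by (simp add: numeral_fps_const fps_const_neg [symmetric] del: fps_const_neg)
    then show ?thesis by (simp only: fps_one_plus_powr_def fps_compose_linear fps_nth_Abs_fps fps_binomial_nth)
  qed
  \<comment> \<open>The product is z^i (1 - 2z)^(r-1-i). For \<open>i < r\<close> the second factor
    is a polynomial of degree \<open>r - 1 - i\<close>, one short of contributing to z^r; for
    \<open>i = r\<close> its constant term 1 gives the coefficient.\<close>
  have monomial: "(g ^ i * ?Q (of_nat r - 1)) $ r = (if i = r then 1 else 0)" if "i \<le> r" for i
  proof -
    have "?Q (of_nat r - 1) = ?Q (of_nat i) * ?Q (of_nat r - 1 - of_nat i)"
      using fps_one_plus_powr_add [OF X0, of "of_nat i" "of_nat r - 1 - of_nat i"] by simp
    also have "?Q (of_nat i) = (1 - 2 * fps_X) ^ i"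
      using fps_one_plus_powr_of_nat [OF X0] by simp
    finally have "g ^ i * ?Q (of_nat r - 1) = fps_X ^ i * ?Q (of_nat r - 1 - of_nat i)"
      by (simp only: mult.assoc [symmetric] power_mult_distrib [symmetric] g)
    then have *: "(g ^ i * ?Q (of_nat r - 1)) $ r
        = (- 2) ^ (r - i) * ((of_nat r - 1 - of_nat i :: complex) gchoose (r - i))"
      using that by (simp add: fps_X_power_mult_nth Q_nth)
    show ?thesis
    proof (cases "i = r")
      case False
      then have "(of_nat r - 1 - of_nat i :: complex) = of_nat (r - i - 1)"
        using that by (simp add: of_nat_diff)
      then have "((of_nat r - 1 - of_nat i :: complex) gchoose (r - i)) = of_nat ((r - i - 1) choose (r - i))"
        by (simp only: binomial_gbinomial)
      also have "(r - i - 1) choose (r - i) = 0"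
        using False that by (intro binomial_eq_0) simp
      finally show ?thesis using * False by simp
    qed (use * in simp)
  qed
  have "((F oo g) * ?Q (of_nat r - 1)) $ r
      = ((\<Sum>i\<le>r. fps_const (F $ i) * g ^ i) * ?Q (of_nat r - 1)) $ r"
  proof (rule fps_nth_mult_cong)
    fix n assume "n \<le> r"
    \<comment> \<open>The additional summands vanish: \<open>g ^ i\<close> has no term of degree
      below \<open>i\<close>.\<close>
    then have "(\<Sum>i = 0..n. F $ i * (g ^ i $ n)) = (\<Sum>i\<le>r. F $ i * (g ^ i $ n))"
      using startsby_zero_power_prefix [OF g0] by (intro sum.mono_neutral_left) auto
    then show "(F oo g) $ n = (\<Sum>i\<le>r. fps_const (F $ i) * g ^ i) $ n"
      by (simp add: fps_compose_nth fps_sum_nth)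
  qed
  also have "\<dots> = (\<Sum>i\<le>r. F $ i * (g ^ i * ?Q (of_nat r - 1)) $ r)"
    by (simp add: sum_distrib_right fps_sum_nth mult.assoc)
  also have "\<dots> = (\<Sum>i\<le>r. if i = r then F $ i else 0)"
    by (intro sum.cong) (simp_all add: monomial)
  also have "\<dots> = F $ r" by simp
  finally show ?thesis .
qed

theorem proposition6p1:
  fixes \<alpha> l :: complex
  shows "matching_fps \<alpha> l oo (- (fps_X / (1 + 2 * fps_X)))
           = fps_one_plus_powr (2 * fps_X) (- \<alpha>) * matching_fps \<alpha> l
    \<and> (\<forall>(h :: complex fps) (r :: nat).
         fps_nth (h * matching_fps \<alpha> l) r
           = fps_nth ((h oo (fps_X / (1 - 2 * fps_X)))
               * fps_one_plus_powr (- (2 * fps_X)) (of_nat r - 1 - \<alpha>)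
               * (matching_fps \<alpha> l oo (- fps_X))) r)"
proof -
  define w g :: "complex fps" where "w = - (fps_X / (1 + 2 * fps_X))"
    and "g = fps_X / (1 - 2 * fps_X)"
  let ?M = "matching_fps \<alpha> l" and ?Q = "fps_one_plus_powr (- (2 * fps_X))"
  have w: "w * (1 + 2 * fps_X) = - fps_X"
    by (simp add: w_def fps_divide_unit mult.assoc inverse_mult_eq_1)
  have g: "g * (1 - 2 * fps_X) = fps_X"
    by (simp add: g_def fps_divide_unit mult.assoc inverse_mult_eq_1)
  have w0: "w $ 0 = 0" and g0: "g $ 0 = 0"
    by (simp_all add: w_def g_def fps_divide_unit)
  have N0: "(- fps_X :: complex fps) $ 0 = 0" and X0: "(2 * fps_X :: complex fps) $ 0 = 0"
    and Q0: "(- (2 * fps_X) :: complex fps) $ 0 = 0"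
    by simp_all
  have two: "(2 * fps_X :: complex fps) oo (- fps_X) = - (2 * fps_X)"
    by (simp add: fps_compose_mult_distrib numeral_fps_const)
  \<comment> \<open>Replacing z by -z turns -z/(1 + 2z) into z/(1 - 2z), so \<open>w\<close> becomes
    \<open>g\<close>; the common factor is cancelled below.\<close>
  have "(w * (1 + 2 * fps_X)) oo (- fps_X) = (- fps_X) oo (- fps_X)"
    by (simp only: w)
  then have "(w oo (- fps_X)) * (1 - 2 * fps_X) = g * (1 - 2 * fps_X)"
    unfolding g by (simp add: fps_compose_mult_distrib [OF N0, of w] fps_compose_add_distrib two
        fps_compose_uminus)
  moreover have "(1 - 2 * fps_X :: complex fps) \<noteq> 0"
    by (metis g fps_X_neq_zero mult_zero_right)
  ultimately have wg: "w oo (- fps_X) = g" by (metis mult_right_cancel)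
  have first: "?M oo w = fps_one_plus_powr (2 * fps_X) (- \<alpha>) * ?M"
    using w by (rule matching_fps_compose)
  \<comment> \<open>The same replacement in the first identity expresses the matching series at
    \<open>g\<close> through its value at -z.\<close>
  then have "?M oo w oo (- fps_X) = ?Q (- \<alpha>) * (?M oo (- fps_X))"
    by (simp only: fps_compose_mult_distrib [OF N0, of _ ?M] fps_one_plus_powr_compose [OF X0 N0] two)
  then have Mg: "?M oo g = ?Q (- \<alpha>) * (?M oo (- fps_X))"
    by (simp only: fps_compose_assoc [OF N0 w0, symmetric] wg)
  have "(h * ?M) $ r = ((h oo g) * ?Q (of_nat r - 1 - \<alpha>) * (?M oo (- fps_X))) $ r" for h r
  proof -
    \<comment> \<open>The part \<open>of_nat r - 1\<close> of the exponent comes from the change of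
      variables, the part \<open>- \<alpha>\<close> from the symmetry.\<close>
    have "?Q (of_nat r - 1 - \<alpha>) = ?Q (of_nat r - 1) * ?Q (- \<alpha>)"
      using fps_one_plus_powr_add [OF Q0, of "of_nat r - 1" "- \<alpha>"] by simp
    then show ?thesis
      using fps_nth_compose_mobius [OF g, of "h * ?M" r]
      by (simp only: fps_compose_mult_distrib [OF g0] Mg mult_ac)
  qed
  then show ?thesis using first unfolding w_def g_def by blast
qed

end
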